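(* Let $t \in \{5,6\}$. Every connected $P_t$-free graph $G$ satisfies $\mathsf{lpt}(G) \le t-2$.
   Context: All graphs are finite and simple. $P_t$ is the chordless path on $t$ vertices; a graph is $P_t$-free if it has no induced subgraph isomorphic to $P_t$. A longest path of a connected graph $G$ is a path of maximum length in $G$; a longest path transversal is a set of vertices meeting every longest path; $\mathsf{lpt}(G)$ is the minimum cardinality of a longest path transversal of $G$. *)

theory Defs
  imports Main
begin

definition simple_graph :: "'a set \<Rightarrow> ('a \<Rightarrow> 'a \<Rightarrow> bool) \<Rightarrow> bool" where
  "simple_graph V E \<longleftrightarrow> finite V \<and> (\<forall>x y. E x y \<longrightarrow> x \<in> V \<and> y \<in> V)
     \<and> (\<forall>x y. E x y \<longrightarrow> E y x) \<and> (\<forall>x. \<not> E x x)"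

text \<open>A path is a nonempty list of distinct vertices, consecutive ones adjacent.
Its length is the number of edges, i.e. length p - 1.\<close>
definition is_path :: "'a set \<Rightarrow> ('a \<Rightarrow> 'a \<Rightarrow> bool) \<Rightarrow> 'a list \<Rightarrow> bool" where
  "is_path V E p \<longleftrightarrow> p \<noteq> [] \<and> distinct p \<and> set p \<subseteq> V
     \<and> (\<forall>i. Suc i < length p \<longrightarrow> E (p ! i) (p ! Suc i))"

definition connected_graph :: "'a set \<Rightarrow> ('a \<Rightarrow> 'a \<Rightarrow> bool) \<Rightarrow> bool" where
  "connected_graph V E \<longleftrightarrow> V \<noteq> {} \<and>
     (\<forall>u\<in>V. \<forall>v\<in>V. \<exists>p. is_path V E p \<and> hd p = u \<and> last p = v)"

definition has_induced_path :: "nat \<Rightarrow> 'a set \<Rightarrow> ('a \<Rightarrow> 'a \<Rightarrow> bool) \<Rightarrow> bool" where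
  "has_induced_path t V E \<longleftrightarrow> (\<exists>p. length p = t \<and> distinct p \<and> set p \<subseteq> V
     \<and> (\<forall>i<t. \<forall>j<t. E (p ! i) (p ! j) \<longleftrightarrow> (i = Suc j \<or> j = Suc i)))"

definition P_free :: "nat \<Rightarrow> 'a set \<Rightarrow> ('a \<Rightarrow> 'a \<Rightarrow> bool) \<Rightarrow> bool" where
  "P_free t V E \<longleftrightarrow> \<not> has_induced_path t V E"

definition longest_path :: "'a set \<Rightarrow> ('a \<Rightarrow> 'a \<Rightarrow> bool) \<Rightarrow> 'a list \<Rightarrow> bool" where
  "longest_path V E p \<longleftrightarrow> is_path V E p \<and> (\<forall>q. is_path V E q \<longrightarrow> length q \<le> length p)"

definition lp_transversal :: "'a set \<Rightarrow> ('a \<Rightarrow> 'a \<Rightarrow> bool) \<Rightarrow> 'a set \<Rightarrow> bool" where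
  "lp_transversal V E S \<longleftrightarrow> S \<subseteq> V \<and> (\<forall>p. longest_path V E p \<longrightarrow> set p \<inter> S \<noteq> {})"

definition lpt :: "'a set \<Rightarrow> ('a \<Rightarrow> 'a \<Rightarrow> bool) \<Rightarrow> nat" where
  "lpt V E = (LEAST k. \<exists>S. lp_transversal V E S \<and> card S = k)"

end

theory Submission
  imports Defs
begin

text \<open>
  For a connected set \<open>S\<close> let \<open>D\<close> be a component of \<open>G - N[S]\<close> containing a longest path \<open>R\<close> of
  \<open>G - N[S]\<close>. If some \<open>w \<in> N(S)\<close> is complete to \<open>D\<close>, then \<open>S \<union> {w}\<close> meets every longest path: a
  longest path \<open>P\<close> missing it must avoid \<open>D\<close>, since \<open>w\<close>, possibly followed by a path in \<open>S\<close>, could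
  be inserted after a vertex of \<open>P\<close> in \<open>D\<close>; but then the initial segment of \<open>P\<close> outside \<open>N[S]\<close>,
  which is not longer than \<open>R\<close>, can be exchanged for \<open>R\<close>, \<open>w\<close> and a path in \<open>S\<close>.

  Hence it suffices to find a connected \<open>S\<close> with at most \<open>t - 3\<close> vertices which is dominating or
  has such a \<open>w\<close>. If there is none, choose \<open>S\<close> minimising first the length of \<open>R\<close> and then the
  number of vertices in components of \<open>G - N[S]\<close> that contain a path of this length. A vertex \<open>w\<close>
  attached to \<open>D\<close> is not complete to it, so there is an edge \<open>x d\<close> in \<open>D\<close> with \<open>w\<close> adjacent to \<open>x\<close>
  only. Put \<open>S' = {w, x}\<close> if \<open>t = 5\<close> and \<open>S' = {w, x, d}\<close> if \<open>t = 6\<close>. If \<open>\<sigma> \<in> S\<close> is attached to a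
  heaviest component \<open>F\<close> of \<open>G - N[S']\<close>, then \<open>\<sigma>\<close> is adjacent to \<open>w\<close> and is mixed on an edge
  \<open>y y'\<close> of \<open>F\<close>, so \<open>(d) x w \<sigma> y y'\<close> is an induced \<open>P\<^sub>t\<close>. Thus \<open>F\<close> avoids \<open>N[S]\<close>, and as \<open>x\<close> lies in
  \<open>D\<close> but in no such \<open>F\<close>, the set \<open>S'\<close> beats \<open>S\<close>.
\<close>

section \<open>Neighbourhoods, paths and components\<close>

definition closed_nbhd :: "('a \<Rightarrow> 'a \<Rightarrow> bool) \<Rightarrow> 'a set \<Rightarrow> 'a set" where
  "closed_nbhd E S = S \<union> {v. \<exists>s\<in>S. E s v}"

definition adj_in :: "'a set \<Rightarrow> ('a \<Rightarrow> 'a \<Rightarrow> bool) \<Rightarrow> 'a \<Rightarrow> 'a \<Rightarrow> bool" where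
  "adj_in U E a b \<longleftrightarrow> a \<in> U \<and> b \<in> U \<and> E a b"

definition component :: "'a set \<Rightarrow> ('a \<Rightarrow> 'a \<Rightarrow> bool) \<Rightarrow> 'a \<Rightarrow> 'a set" where
  "component U E r = {v. (adj_in U E)\<^sup>*\<^sup>* r v}"

lemma is_path_successively:
  "is_path V E p \<longleftrightarrow> p \<noteq> [] \<and> distinct p \<and> set p \<subseteq> V \<and> successively E p"
  by (auto simp: is_path_def successively_conv_nth)

lemma is_path_mono: "is_path U E p \<Longrightarrow> set p \<subseteq> W \<Longrightarrow> is_path W E p"
  by (auto simp: is_path_def)

lemma is_path_hd: "is_path U E p \<Longrightarrow> hd p \<in> U"
  by (auto simp: is_path_def subset_iff)

lemma is_path_append:
  assumes "is_path V E p" "is_path V E q" "set p \<inter> set q = {}" "E (last p) (hd q)"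
  shows "is_path V E (p @ q)"
  using assms by (auto simp: is_path_successively successively_append_iff)

lemma is_path_appendD:
  assumes "is_path V E (p @ q)"
  shows "p \<noteq> [] \<Longrightarrow> is_path V E p" "q \<noteq> [] \<Longrightarrow> is_path V E q"
    "p \<noteq> [] \<Longrightarrow> q \<noteq> [] \<Longrightarrow> E (last p) (hd q)"
  using assms unfolding is_path_successively by (simp_all add: successively_append_iff)

text \<open>Splicing \<open>T\<close> between \<open>A\<close> and \<open>B\<close> would produce a
  longer path.\<close>

lemma longest_path_insert:
  assumes "longest_path V E (A @ B)" "A \<noteq> []" "B \<noteq> []" "is_path V E T"
    "set T \<inter> set (A @ B) = {}" "E (last A) (hd T)" "E (last T) (hd B)"
  shows False
proof -
  have ab: "is_path V E (A @ B)" using assms(1) by (simp add: longest_path_def)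
  have T: "T \<noteq> []" using assms(4) by (simp add: is_path_def)
  have dAB: "set A \<inter> set B = {}" using ab by (simp add: is_path_def)
  have "is_path V E (A @ T)"
    using is_path_append is_path_appendD(1)[OF ab] assms by fastforce
  then have "is_path V E ((A @ T) @ B)"
    using is_path_append[of V E "A @ T" B] is_path_appendD(2)[OF ab] assms T dAB by auto
  then have "length ((A @ T) @ B) \<le> length (A @ B)"
    using assms(1) unfolding longest_path_def by blast
  then show False using T by simp
qed

lemma rtranclp_crossing:
  assumes "r\<^sup>*\<^sup>* a b" "Q a" "\<not> Q b"
  shows "\<exists>x y. r\<^sup>*\<^sup>* a x \<and> r x y \<and> Q x \<and> \<not> Q y"
  using assms by (induction rule: rtranclp_induct) blast+

lemma component_step:
  "v \<in> component U E r \<Longrightarrow> v \<in> U \<Longrightarrow> u \<in> U \<Longrightarrow> E v u \<Longrightarrow> u \<in> component U E r"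
  unfolding component_def adj_in_def
  by (metis (mono_tags, lifting) mem_Collect_eq rtranclp.rtrancl_into_rtrancl)

lemma component_subset: "r \<in> U \<Longrightarrow> component U E r \<subseteq> U"
proof
  fix v assume "r \<in> U" "v \<in> component U E r"
  then have "(adj_in U E)\<^sup>*\<^sup>* r v" by (simp add: component_def)
  then show "v \<in> U" using \<open>r \<in> U\<close> by (induction rule: rtranclp_induct) (auto simp: adj_in_def)
qed

lemma component_self: "r \<in> component U E r"
  by (simp add: component_def)

lemma path_in_component:
  assumes "is_path U E p"
  shows "set p \<subseteq> component U E (hd p)"
proof -
  have "i < length p \<Longrightarrow> p ! i \<in> component U E (hd p)" for i
  proof (induction i)
    case 0
    then show ?case by (simp add: component_self hd_conv_nth)
  next
    case (Suc i)
    then show ?case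
      using assms component_step[of "p ! i" U E "hd p" "p ! Suc i"]
      by (auto simp: is_path_def subset_iff)
  qed
  then show ?thesis by (auto simp: in_set_conv_nth)
qed

section \<open>Connected simple graphs\<close>

locale conn_graph =
  fixes V :: "'a set" and E :: "'a \<Rightarrow> 'a \<Rightarrow> bool"
  assumes simple: "simple_graph V E" and connected: "connected_graph V E"
begin

lemma finite_V: "finite V" and E_sym: "E x y \<Longrightarrow> E y x" and E_irrefl: "\<not> E x x"
  and E_V: "E x y \<Longrightarrow> x \<in> V \<and> y \<in> V"
  using simple unfolding simple_graph_def by blast+

lemma E_commute: "E x y \<longleftrightarrow> E y x"
  using E_sym by blast

lemma component_sym: "y \<in> component U E x \<Longrightarrow> x \<in> component U E y"
proof -
  have "symp (adj_in U E)" by (auto simp: E_commute symp_def adj_in_def)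
  then show "y \<in> component U E x \<Longrightarrow> x \<in> component U E y"
    unfolding component_def by (metis mem_Collect_eq symp_rtranclp sympD)
qed

lemma connected_exit:
  assumes "D \<subseteq> V" "a \<in> D" "b \<in> V - D"
  shows "\<exists>x\<in>D. \<exists>y\<in>V - D. E x y"
proof -
  obtain p where p: "is_path V E p" "hd p = a" "last p = b"
    using connected assms unfolding connected_graph_def by blast
  then have "b \<in> component V E a"
    using path_in_component[OF p(1)] by (auto simp: is_path_def)
  then show ?thesis
    using rtranclp_crossing[of "adj_in V E" a b "\<lambda>v. v \<in> D"] assms
    unfolding component_def adj_in_def by blast
qed

abbreviation rest :: "'a set \<Rightarrow> 'a set" where
  "rest S \<equiv> V - closed_nbhd E S"

section \<open>Transversals from connected sets\<close>

text \<open>A longest path missing \<open>S\<close> would start at a neighbour of some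
  \<open>s\<close> in \<open>S\<close>, and prepending \<open>s\<close> would lengthen it.\<close>

lemma rest_empty_transversal:
  assumes "S \<subseteq> V" "rest S = {}"
  shows "lp_transversal V E S"
  unfolding lp_transversal_def
proof (intro conjI allI impI notI)
  fix P assume P: "longest_path V E P" and miss: "set P \<inter> S = {}"
  have pP: "is_path V E P" using P by (simp add: longest_path_def)
  then have hd: "hd P \<in> V" "hd P \<in> set P" by (auto simp: is_path_def)
  then obtain s where s: "s \<in> S" "E s (hd P)"
    using assms miss by (auto simp: closed_nbhd_def)
  have "is_path V E ([s] @ P)"
    by (rule is_path_append) (use s pP miss assms in \<open>auto simp: is_path_def\<close>)
  then show False using P by (force simp: longest_path_def)
qed (use assms in auto)

lemma complete_attachment_transversal:
  assumes S: "S \<subseteq> V" "connected_graph S E"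
    and R: "longest_path (rest S) E R"
    and w: "w \<in> V" "w \<notin> S" "\<tau> \<in> S" "E w \<tau>"
    and complete: "\<And>v. v \<in> component (rest S) E (hd R) \<Longrightarrow> E w v"
  shows "lp_transversal V E (insert w S)"
  unfolding lp_transversal_def
proof (intro conjI allI impI notI)
  let ?D = "component (rest S) E (hd R)"
  fix P assume P: "longest_path V E P" and miss: "set P \<inter> insert w S = {}"
  have pP: "is_path V E P" using P by (simp add: longest_path_def)
  have Pmax: "\<And>q. is_path V E q \<Longrightarrow> length q \<le> length P" using P by (simp add: longest_path_def)
  have pR: "is_path (rest S) E R" using R by (simp add: longest_path_def)
  have RD: "set R \<subseteq> ?D" by (rule path_in_component[OF pR])
  have Rne: "R \<noteq> []" using pR by (simp add: is_path_def)
  have DU: "?D \<subseteq> rest S"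
    by (rule component_subset) (rule is_path_hd[OF pR])
  \<comment> \<open>The detour goes from \<open>w\<close> through \<open>S\<close> to a neighbour of
    \<open>z\<close>. It is disjoint from \<open>P\<close>, because \<open>P\<close> misses
    \<open>insert w S\<close>.\<close>
  have bridge: "\<exists>T. is_path V E T \<and> hd T = w \<and> set T \<subseteq> insert w S \<and> E (last T) z"
    if z: "z \<in> closed_nbhd E S" "z \<notin> S" for z
  proof -
    obtain \<sigma> where \<sigma>: "\<sigma> \<in> S" "E \<sigma> z" using z by (auto simp: closed_nbhd_def)
    obtain T where T: "is_path S E T" "hd T = \<tau>" "last T = \<sigma>"
      using S(2) w(3) \<sigma>(1) unfolding connected_graph_def by blast
    have TS: "set T \<subseteq> S" "T \<noteq> []" using T(1) by (auto simp: is_path_def)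
    have "is_path V E ([w] @ T)"
      by (rule is_path_append)
        (use T TS w S in \<open>auto simp: is_path_def\<close>)
    then show ?thesis using T TS \<sigma> by (intro exI[of _ "[w] @ T"]) auto
  qed
  \<comment> \<open>After \<open>p\<close>, the path \<open>P\<close> ends, stays in
    \<open>?D\<close> or enters the neighbourhood of \<open>S\<close>. In the first two cases
    \<open>[w]\<close> fits in behind \<open>p\<close>, in the third a bridge does.\<close>
  have disj: "p \<notin> ?D" if p: "p \<in> set P" for p
  proof
    assume pD: "p \<in> ?D"
    obtain A B where AB: "P = A @ p # B" using p by (auto simp: in_set_conv_decomp)
    have wp: "E p w" using complete[OF pD] E_sym by blast
    have pw: "is_path V E [w]" using w by (simp add: is_path_def)
    show False
    proof (cases B)
      case Nil
      have "is_path V E (P @ [w])"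
        by (rule is_path_append[OF pP pw]) (use AB Nil miss wp in auto)
      then show False using Pmax by fastforce
    next
      case (Cons q B')
      have P': "longest_path V E ((A @ [p]) @ (q # B'))" using P AB Cons by simp
      have Epq: "E p q" using is_path_appendD(3)[of V E "A @ [p]" "q # B'"] pP AB Cons by simp
      have "\<exists>T. is_path V E T \<and> hd T = w \<and> set T \<subseteq> insert w S \<and> E (last T) q"
      proof (cases "q \<in> ?D")
        case True
        then show ?thesis using pw complete by (intro exI[of _ "[w]"]) auto
      next
        case False
        then have "q \<in> closed_nbhd E S"
          using component_step[OF pD, of q] Epq pD DU E_V[OF Epq] by blast
        moreover have "q \<notin> S" using miss AB Cons by auto
        ultimately show ?thesis by (rule bridge)
      qed
      then obtain T where T: "is_path V E T" "hd T = w" "set T \<subseteq> insert w S" "E (last T) q"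
        by blast
      show False
        by (rule longest_path_insert[OF P' _ _ T(1)]) (use T wp miss AB Cons in auto)
    qed
  qed
  \<comment> \<open>Cutting \<open>P\<close> at its first vertex in \<open>closed_nbhd E S\<close>
    leaves a prefix \<open>Q\<close> inside \<open>rest S\<close>, hence no longer than
    \<open>R\<close>.\<close>
  define Q where "Q = takeWhile (\<lambda>v. v \<notin> closed_nbhd E S) P"
  define P' where "P' = dropWhile (\<lambda>v. v \<notin> closed_nbhd E S) P"
  have QP: "P = Q @ P'" by (simp add: Q_def P'_def)
  have Q_len: "length Q \<le> length R"
  proof (cases "Q = []")
    case False
    then have "is_path V E Q" using is_path_appendD(1)[of V E Q P'] pP QP by simp
    then have "is_path (rest S) E Q"
      by (rule is_path_mono) (use \<open>is_path V E Q\<close> in \<open>auto simp: is_path_def Q_def dest: set_takeWhileD\<close>)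
    then show ?thesis using R by (simp add: longest_path_def)
  qed simp
  have pRV: "is_path V E R" using pR by (rule is_path_mono) (use RD DU in auto)
  have ERw: "E (last R) w" using complete E_sym RD Rne by (meson last_in_set subsetD)
  have wR: "w \<notin> set R" using complete E_irrefl RD by blast
  show False
  proof (cases "P' = []")
    case True
    have "is_path V E (R @ [w])"
      by (rule is_path_append[OF pRV]) (use w ERw wR in \<open>auto simp: is_path_def\<close>)
    then show False using Pmax[of "R @ [w]"] Q_len QP True by simp
  next
    case False
    have z: "hd P' \<in> closed_nbhd E S" using hd_dropWhile False P'_def by blast
    have zS: "hd P' \<notin> S" using miss hd_in_set[OF False] QP by auto
    obtain T where T: "is_path V E T" "hd T = w" "set T \<subseteq> insert w S" "E (last T) (hd P')"
      using bridge[OF z zS] by blast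
    have Tne: "T \<noteq> []" using T(1) by (simp add: is_path_def)
    have RS: "set R \<inter> S = {}" using RD DU by (auto simp: closed_nbhd_def)
    have 1: "is_path V E (R @ T)"
      by (rule is_path_append[OF pRV T(1)]) (use T RS wR ERw in auto)
    have 2: "is_path V E P'" using is_path_appendD(2)[of V E Q P'] pP QP False by simp
    \<comment> \<open>\<open>P'\<close> avoids \<open>R\<close> by \<open>disj\<close> and
      \<open>T\<close> by \<open>miss\<close>. As \<open>T\<close> is nonempty, the new path is
      strictly longer than \<open>P\<close>.\<close>
    have "is_path V E ((R @ T) @ P')"
      by (rule is_path_append[OF 1 2]) (use T Tne miss QP disj RD in auto)
    then have "length ((R @ T) @ P') \<le> length P" by (rule Pmax)
    then show False using Q_len QP Tne by (cases T) auto
  qed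
qed (use w S in auto)

section \<open>The weight of a connected set\<close>

lemma finite_path_lengths: "U \<subseteq> V \<Longrightarrow> finite (length ` {p. is_path U E p})"
proof (rule finite_subset[of _ "{..card V}"])
  assume U: "U \<subseteq> V"
  show "length ` {p. is_path U E p} \<subseteq> {..card V}"
  proof clarsimp
    fix p assume "is_path U E p"
    then have "set p \<subseteq> V" "distinct p" using U by (auto simp: is_path_def)
    then show "length p \<le> card V"
      using card_mono[OF finite_V] distinct_card by metis
  qed
qed simp

text \<open>Counts vertices, as \<open>length\<close> does. \<open>Max {}\<close> is unspecified, so
  the value is meaningful only for nonempty \<open>rest S\<close>.\<close>

definition rest_length :: "'a set \<Rightarrow> nat" where
  "rest_length S = Max (length ` {p. is_path (rest S) E p})"

lemma path_length_le: "is_path (rest S) E p \<Longrightarrow> length p \<le> rest_length S"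
  unfolding rest_length_def by (rule Max_ge) (auto intro: finite_path_lengths)

text \<open>Turns maximality into an equation between numbers, so that paths for different sets
  \<open>S\<close> can be compared.\<close>

lemma longest_path_rest:
  "longest_path (rest S) E p \<longleftrightarrow> is_path (rest S) E p \<and> length p = rest_length S"
proof
  assume "longest_path (rest S) E p"
  then have p: "is_path (rest S) E p" "\<And>q. is_path (rest S) E q \<Longrightarrow> length q \<le> length p"
    by (auto simp: longest_path_def)
  have "rest_length S = length p"
    unfolding rest_length_def by (rule Max_eqI) (use p in \<open>auto intro: finite_path_lengths\<close>)
  with p show "is_path (rest S) E p \<and> length p = rest_length S" by simp
qed (auto simp: longest_path_def path_length_le)

lemma longest_path_rest_exists:
  assumes "rest S \<noteq> {}"
  shows "\<exists>R. longest_path (rest S) E R"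
proof -
  obtain v where "v \<in> rest S" using assms by blast
  then have "is_path (rest S) E [v]" by (simp add: is_path_def)
  then have "rest_length S \<in> length ` {p. is_path (rest S) E p}"
    unfolding rest_length_def by (intro Max_in) (auto intro: finite_path_lengths)
  then show ?thesis by (auto simp: longest_path_rest)
qed

text \<open>A path stays in one component, so \<open>hd R\<close> identifies the component
  containing \<open>R\<close>.\<close>

definition heavy :: "'a set \<Rightarrow> 'a set" where
  "heavy S = (\<Union>R \<in> {R. longest_path (rest S) E R}. component (rest S) E (hd R))"

lemma heavy_subset: "heavy S \<subseteq> rest S"
proof
  fix v assume "v \<in> heavy S"
  then obtain R where R: "is_path (rest S) E R" "v \<in> component (rest S) E (hd R)"
    by (auto simp: heavy_def longest_path_def)
  then have "hd R \<in> rest S" by (simp only: is_path_hd)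
  then show "v \<in> rest S" using component_subset R(2) by (metis subsetD)
qed

text \<open>Encodes the lexicographic order, because \<open>heavy S\<close> has at most \<open>card V\<close> elements.\<close>
definition weight :: "'a set \<Rightarrow> nat" where
  "weight S = rest_length S * Suc (card V) + card (heavy S)"

text \<open>By \<open>sub\<close>, the longest paths of \<open>rest S'\<close> survive in
  \<open>rest S\<close>, so \<open>rest_length\<close> does not grow. If it stays equal, they are
  longest there too; then \<open>heavy S'\<close> lies in \<open>heavy S\<close>, and
  \<open>x\<close> makes the inclusion strict.\<close>

lemma weight_less:
  assumes ne: "rest S' \<noteq> {}"
    and sub: "\<And>R. longest_path (rest S') E R \<Longrightarrow> component (rest S') E (hd R) \<subseteq> rest S"
    and x: "x \<in> heavy S" "x \<notin> rest S'"
  shows "weight S' < weight S"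
proof -
  have le: "length R \<le> rest_length S" if R: "longest_path (rest S') E R" for R
  proof (rule path_length_le)
    have "is_path (rest S') E R" using R by (simp add: longest_path_def)
    then show "is_path (rest S) E R"
      using is_path_mono path_in_component sub[OF R] by (metis subset_trans)
  qed
  obtain R0 where R0: "longest_path (rest S') E R0" using longest_path_rest_exists[OF ne] by blast
  have len: "rest_length S' \<le> rest_length S" using le[OF R0] R0 by (simp add: longest_path_rest)
  have card_le: "card (heavy S') \<le> card V"
    by (rule card_mono[OF finite_V]) (use heavy_subset in blast)
  show ?thesis
  proof (cases "rest_length S' = rest_length S")
    case False
    then have "Suc (rest_length S') \<le> rest_length S" using len by simp
    then have "Suc (rest_length S') * Suc (card V) \<le> rest_length S * Suc (card V)"
      by (rule mult_le_mono1)
    then show ?thesis using card_le unfolding weight_def by simp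
  next
    case True
    have "heavy S' \<subseteq> heavy S"
    proof
      fix v assume "v \<in> heavy S'"
      then obtain R where R: "longest_path (rest S') E R" "v \<in> component (rest S') E (hd R)"
        by (auto simp: heavy_def)
      have pR: "is_path (rest S') E R" using R by (simp add: longest_path_def)
      then have "is_path (rest S) E R"
        using is_path_mono path_in_component sub[OF R(1)] by (metis subset_trans)
      then have "longest_path (rest S) E R" using R(1) True by (simp add: longest_path_rest)
      moreover have "(adj_in (rest S') E)\<^sup>*\<^sup>* (hd R) v" using R(2) by (simp add: component_def)
      then have "(adj_in (rest S) E)\<^sup>*\<^sup>* (hd R) v"
      \<comment> \<open>Every edge of the walk lies within the component, which \<open>sub\<close>
        places inside \<open>rest S\<close>.\<close>
      proof (induction rule: rtranclp_induct)
        case (step y z)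
        then have "y \<in> component (rest S') E (hd R)" "z \<in> component (rest S') E (hd R)"
          by (auto simp: component_def intro: rtranclp.rtrancl_into_rtrancl)
        then have "adj_in (rest S) E y z" using sub[OF R(1)] step by (auto simp: adj_in_def)
        then show ?case using step by (meson rtranclp.rtrancl_into_rtrancl)
      qed simp
      ultimately show "v \<in> heavy S" by (auto simp: heavy_def component_def)
    qed
    moreover have "x \<notin> heavy S'" using x heavy_subset by blast
    ultimately have "heavy S' \<subset> heavy S" using x by blast
    moreover have "finite (heavy S)"
      by (rule finite_subset[OF _ finite_V]) (use heavy_subset in blast)
    ultimately show ?thesis using True psubset_card_mono unfolding weight_def by simp
  qed
qed

section \<open>Vertices mixed on an edge of a component\<close>

text \<open>Adjacency to \<open>w\<close> must change along a walk from \<open>a\<close> to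
  \<open>b\<close> in the component.\<close>

lemma component_crossing:
  assumes "E w a" "a \<in> component U E r" "b \<in> component U E r" "\<not> E w b"
  obtains x y where "x \<in> component U E r" "y \<in> component U E r" "E x y" "E w x" "\<not> E w y"
proof -
  have "b \<in> component U E a"
    using component_sym[OF assms(2)] assms(3) unfolding component_def by auto
  then obtain x y where xy: "(adj_in U E)\<^sup>*\<^sup>* a x" "adj_in U E x y" "E w x" "\<not> E w y"
    using rtranclp_crossing[of "adj_in U E" a b "E w"] assms unfolding component_def by blast
  moreover have "(adj_in U E)\<^sup>*\<^sup>* r x" using xy(1) assms(2) unfolding component_def by auto
  moreover from this have "(adj_in U E)\<^sup>*\<^sup>* r y" using xy(2) by auto
  ultimately show thesis using that[of x y] by (auto simp: component_def adj_in_def)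
qed

text \<open>If \<open>w\<close> were complete to the component,
  \<open>complete_attachment_transversal\<close> would make \<open>insert w S\<close> a
  transversal.\<close>

lemma incomplete_attachment:
  assumes "S \<subseteq> V" "connected_graph S E" "longest_path (rest S) E R"
    and "\<not> lp_transversal V E (insert w S)"
    and "w \<in> closed_nbhd E S" "w \<notin> S" "a \<in> component (rest S) E (hd R)" "E w a"
  obtains x y where "x \<in> component (rest S) E (hd R)" "y \<in> component (rest S) E (hd R)"
    "E x y" "E w x" "\<not> E w y"
proof -
  obtain \<tau> where \<tau>: "\<tau> \<in> S" "E w \<tau>" using assms by (auto simp: E_commute closed_nbhd_def)
  then have "w \<in> V" using E_V by blast
  then obtain b where "b \<in> component (rest S) E (hd R)" "\<not> E w b"
    using complete_attachment_transversal[OF assms(1-3) _ assms(6) \<tau>] assms(4) by blast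
  then show thesis using component_crossing assms(7,8) that by metis
qed

section \<open>The minimality argument\<close>

text \<open>\<open>replace\<close> isolates what depends on \<open>t\<close>, with
  \<open>k = t - 3\<close>. Its last clause excludes \<open>w\<close>, \<open>\<sigma>\<close>,
  \<open>y\<close>, \<open>y'\<close> as the end of an induced path on \<open>t\<close> vertices
  that starts in \<open>S'\<close>.\<close>

lemma small_transversal:
  assumes k: "1 \<le> k"
    and replace: "\<And>S D w x d. \<lbrakk>S \<subseteq> V; w \<in> V; D \<inter> closed_nbhd E S = {}; x \<in> D; d \<in> D;
        E x d; E w x; \<not> E w d; w \<notin> D\<rbrakk> \<Longrightarrow>
      \<exists>S'. S' \<subseteq> V \<and> connected_graph S' E \<and> card S' \<le> k \<and> w \<in> S' \<and> x \<in> S' \<and> S' \<subseteq> insert w D \<and>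
        (\<forall>\<sigma> y y'. \<sigma> \<in> S \<longrightarrow> E w \<sigma> \<longrightarrow> E \<sigma> y \<longrightarrow> E y y' \<longrightarrow> \<not> E \<sigma> y' \<longrightarrow>
           y \<in> rest S' \<longrightarrow> y' \<in> rest S' \<longrightarrow> False)"
  shows "\<exists>S. lp_transversal V E S \<and> card S \<le> Suc k"
proof (rule ccontr)
  assume no: "\<not> ?thesis"
  define ok where "ok S \<longleftrightarrow> S \<subseteq> V \<and> connected_graph S E \<and> card S \<le> k" for S
  have ne: "rest S \<noteq> {}" if "ok S" for S
    using rest_empty_transversal[of S] that no by (auto simp: ok_def)
  have noins: "\<not> lp_transversal V E (insert w S)" if "ok S" for w S
    using that no card_insert_le_m1[of "Suc k" S w] by (auto simp: ok_def)
  obtain v0 where "v0 \<in> V" using connected by (auto simp: connected_graph_def)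
  \<comment> \<open>A single vertex starts the minimisation; its size is allowed by
    \<open>1 \<le> k\<close>.\<close>
  then have "ok {v0}"
    using k by (auto simp: ok_def connected_graph_def is_path_def intro!: exI[of _ "[v0]"])
  then obtain S where S: "ok S" and min: "\<And>S'. ok S' \<Longrightarrow> weight S \<le> weight S'"
    using ex_has_least_nat[of ok "{v0}" weight] by blast
  have SV: "S \<subseteq> V" "connected_graph S E" using S by (auto simp: ok_def)
  obtain R where R: "longest_path (rest S) E R" using longest_path_rest_exists[OF ne[OF S]] by blast
  define D where "D = component (rest S) E (hd R)"
  have hdR: "hd R \<in> rest S"
    using R is_path_hd unfolding longest_path_def by blast
  have DU: "D \<subseteq> rest S" unfolding D_def by (rule component_subset[OF hdR])
  obtain s0 where s0: "s0 \<in> S" using SV(2) by (auto simp: connected_graph_def)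
  have "s0 \<in> V - D" using s0 SV DU by (auto simp: closed_nbhd_def)
  then obtain a w where aw: "a \<in> D" "w \<in> V - D" "E a w"
    using connected_exit[of D "hd R" s0] DU component_self[of "hd R"] by (auto simp: D_def)
  \<comment> \<open>\<open>D\<close> is a component of \<open>rest S\<close>, so a neighbour of
    \<open>D\<close> outside \<open>D\<close> cannot lie in \<open>rest S\<close>.\<close>
  have wN: "w \<in> closed_nbhd E S"
    using component_step[of a "rest S" E "hd R" w] aw DU by (auto simp: D_def)
  have wS: "w \<notin> S" using aw DU by (auto simp: E_commute closed_nbhd_def)
  obtain x d where xd: "x \<in> D" "d \<in> D" "E x d" "E w x" "\<not> E w d"
    using incomplete_attachment[OF SV R noins[OF S] wN wS, of a] aw by (auto simp: E_commute D_def)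
  obtain S' where S': "S' \<subseteq> V" "connected_graph S' E" "card S' \<le> k" "w \<in> S'" "x \<in> S'"
      "S' \<subseteq> insert w D"
    and bad: "\<And>\<sigma> y y'. \<lbrakk>\<sigma> \<in> S; E w \<sigma>; E \<sigma> y; E y y'; \<not> E \<sigma> y'; y \<in> rest S'; y' \<in> rest S'\<rbrakk> \<Longrightarrow> False"
    using replace[of S w D x d] SV aw DU xd by blast
  have ok': "ok S'" using S' by (simp add: ok_def)
  have "component (rest S') E (hd R') \<subseteq> rest S" if R': "longest_path (rest S') E R'" for R'
  proof -
    define F where "F = component (rest S') E (hd R')"
    have hdR': "hd R' \<in> rest S'"
      using R' is_path_hd unfolding longest_path_def by blast
    have FU: "F \<subseteq> rest S'" unfolding F_def by (rule component_subset[OF hdR'])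
    have anti: "\<not> E \<sigma> f" if \<sigma>: "\<sigma> \<in> S" "\<sigma> \<notin> F" and f: "f \<in> F" for \<sigma> f
    proof
      assume e: "E \<sigma> f"
      have "\<sigma> \<in> closed_nbhd E S'"
        using component_step[of f "rest S'" E "hd R'" \<sigma>] \<sigma> f FU e E_sym E_V F_def by blast
      moreover have nS': "\<sigma> \<notin> S'" using e f FU by (auto simp: closed_nbhd_def)
      \<comment> \<open>As \<open>D\<close> avoids \<open>closed_nbhd E S\<close>, the only possible
        neighbour of \<open>\<sigma>\<close> in \<open>S'\<close> is \<open>w\<close>.\<close>
      moreover have "\<not> E v \<sigma>" if "v \<in> D" for v
        using that DU \<sigma> E_sym unfolding closed_nbhd_def by blast
      ultimately have w\<sigma>: "E w \<sigma>" using S'(6) by (auto simp: closed_nbhd_def)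
      have "\<sigma> \<in> closed_nbhd E S'" by fact
      then obtain y y' where "y \<in> F" "y' \<in> F" "E y y'" "E \<sigma> y" "\<not> E \<sigma> y'"
        using incomplete_attachment[OF S'(1,2) R' noins[OF ok'] _ nS', of f] e f
        unfolding F_def by blast
      then show False using bad[OF \<sigma>(1) w\<sigma>] FU by blast
    qed
    \<comment> \<open>This \<open>s\<close> lies outside \<open>F\<close>. If \<open>F\<close> met
      \<open>S\<close>, a path to \<open>s\<close> inside the connected set \<open>S\<close> would
      leave \<open>F\<close> along an edge excluded by \<open>anti\<close>.\<close>
    obtain s where s: "s \<in> S" "E w s" using wN wS by (auto simp: E_commute closed_nbhd_def)
    then have sF: "s \<notin> F" using FU S'(4) by (auto simp: closed_nbhd_def)
    have "F \<inter> S = {}"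
    proof (rule ccontr)
      assume "F \<inter> S \<noteq> {}"
      then obtain f where f: "f \<in> F" "f \<in> S" by blast
      obtain p where p: "is_path S E p" "hd p = f" "last p = s"
        using SV(2) f s unfolding connected_graph_def by blast
      then have "s \<in> component S E f"
        using path_in_component[OF p(1)] by (auto simp: is_path_def)
      then show False
        using rtranclp_crossing[of "adj_in S E" f s "\<lambda>v. v \<in> F"] f sF anti E_sym
        unfolding component_def adj_in_def by blast
    qed
    then have "F \<subseteq> rest S" using anti FU unfolding closed_nbhd_def by blast
    then show ?thesis by (simp add: F_def)
  qed
  moreover have "x \<in> heavy S" using xd R by (auto simp: heavy_def D_def)
  moreover have "x \<notin> rest S'" using S' by (auto simp: closed_nbhd_def)
  ultimately have "weight S' < weight S" using weight_less ne[OF ok'] by blast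
  then show False using min[OF ok'] by simp
qed

section \<open>Induced paths and small connected sets\<close>

text \<open>Distinctness follows from the adjacency pattern: no two vertices have the same
  neighbours on the path.\<close>

lemma induced_path_5:
  assumes "E a b" "E b c" "E c d" "E d e"
    "\<not> E a c" "\<not> E a d" "\<not> E a e" "\<not> E b d" "\<not> E b e" "\<not> E c e"
  shows "has_induced_path 5 V E"
  unfolding has_induced_path_def
proof (intro exI[of _ "[a, b, c, d, e]"] conjI)
  show "distinct [a, b, c, d, e]" using assms by (auto simp: E_commute E_irrefl)
  show "set [a, b, c, d, e] \<subseteq> V" using assms E_V by auto
  have "\<not> E c a" "\<not> E d a" "\<not> E e a" "\<not> E d b" "\<not> E e b" "\<not> E e c"
    "E b a" "E c b" "E d c" "E e d"
    using assms E_sym by blast+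
  then show "\<forall>i<5. \<forall>j<5. E ([a, b, c, d, e] ! i) ([a, b, c, d, e] ! j) \<longleftrightarrow> i = Suc j \<or> j = Suc i"
    using assms E_irrefl by (simp add: All_less_Suc numeral_eq_Suc)
qed simp

lemma induced_path_6:
  assumes "E a b" "E b c" "E c d" "E d e" "E e f"
    "\<not> E a c" "\<not> E a d" "\<not> E a e" "\<not> E a f" "\<not> E b d" "\<not> E b e" "\<not> E b f"
    "\<not> E c e" "\<not> E c f" "\<not> E d f"
  shows "has_induced_path 6 V E"
  unfolding has_induced_path_def
proof (intro exI[of _ "[a, b, c, d, e, f]"] conjI)
  show "distinct [a, b, c, d, e, f]" using assms by (auto simp: E_commute E_irrefl)
  show "set [a, b, c, d, e, f] \<subseteq> V" using assms E_V by auto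
  have "\<not> E c a" "\<not> E d a" "\<not> E e a" "\<not> E f a" "\<not> E d b" "\<not> E e b" "\<not> E f b"
    "\<not> E e c" "\<not> E f c" "\<not> E f d" "E b a" "E c b" "E d c" "E e d" "E f e"
    using assms E_sym by blast+
  then show "\<forall>i<6. \<forall>j<6. E ([a, b, c, d, e, f] ! i) ([a, b, c, d, e, f] ! j)
      \<longleftrightarrow> i = Suc j \<or> j = Suc i"
    using assms E_irrefl by (simp add: All_less_Suc numeral_eq_Suc)
qed simp

lemma connected_graph_edge:
  assumes "E w x"
  shows "connected_graph {w, x} E"
proof -
  have "w \<noteq> x" using assms E_irrefl by blast
  then have "is_path {w, x} E [w]" "is_path {w, x} E [x]"
    "is_path {w, x} E [w, x]" "is_path {w, x} E [x, w]"
    using assms by (auto simp: E_commute is_path_successively)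
  then show ?thesis unfolding connected_graph_def
    by (metis empty_iff insertE insert_not_empty last.simps list.distinct(1) list.sel(1))
qed

lemma connected_graph_path3:
  assumes "E w x" "E x d" "w \<noteq> d"
  shows "connected_graph {w, x, d} E"
proof -
  let ?U = "{w, x, d}"
  have ne: "w \<noteq> x" "x \<noteq> d" using assms E_irrefl by blast+
  then have "is_path ?U E [w]" "is_path ?U E [x]" "is_path ?U E [d]"
    "is_path ?U E [w, x]" "is_path ?U E [x, w]" "is_path ?U E [x, d]" "is_path ?U E [d, x]"
    "is_path ?U E [w, x, d]" "is_path ?U E [d, x, w]"
    using assms by (auto simp: E_commute is_path_successively)
  then show ?thesis unfolding connected_graph_def
    by (metis empty_iff insertE insert_not_empty last.simps list.distinct(1) list.sel(1))
qed

section \<open>The two values of \<open>t\<close>\<close>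

lemma transversal_P5_free:
  assumes "P_free 5 V E"
  shows "\<exists>S. lp_transversal V E S \<and> card S \<le> Suc 2"
proof (rule small_transversal)
  fix S D w x d
  assume h: "S \<subseteq> V" "w \<in> V" "D \<inter> closed_nbhd E S = {}" "x \<in> D" "d \<in> D"
    "E x d" "E w x" "\<not> E w d" "w \<notin> D"
  have "False" if "\<sigma> \<in> S" "E w \<sigma>" "E \<sigma> y" "E y y'" "\<not> E \<sigma> y'"
    "y \<in> rest {w, x}" "y' \<in> rest {w, x}" for \<sigma> y y'
  proof -
    \<comment> \<open>\<open>x\<close> lies in \<open>D\<close>, which avoids
      \<open>closed_nbhd E S\<close>. The vertices \<open>y\<close> and \<open>y'\<close> are
      nonadjacent to \<open>w\<close> and \<open>x\<close> as members of
      \<open>rest {w, x}\<close>.\<close>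
    have "\<not> E x \<sigma>" using h that E_sym unfolding closed_nbhd_def by blast
    then have "has_induced_path 5 V E"
      using h that by (intro induced_path_5[of x w \<sigma> y y']) (auto simp: E_commute closed_nbhd_def)
    then show False using assms by (simp add: P_free_def)
  qed
  moreover have "x \<in> V" "card {w, x} \<le> 2" using h E_V by (auto simp: card_insert_if)
  ultimately show "\<exists>S'. S' \<subseteq> V \<and> connected_graph S' E \<and> card S' \<le> 2 \<and> w \<in> S' \<and> x \<in> S' \<and>
      S' \<subseteq> insert w D \<and>
      (\<forall>\<sigma> y y'. \<sigma> \<in> S \<longrightarrow> E w \<sigma> \<longrightarrow> E \<sigma> y \<longrightarrow> E y y' \<longrightarrow> \<not> E \<sigma> y' \<longrightarrow>
        y \<in> rest S' \<longrightarrow> y' \<in> rest S' \<longrightarrow> False)"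
    using h connected_graph_edge[of w x] by (intro exI[of _ "{w, x}"]) blast
qed simp

lemma transversal_P6_free:
  assumes "P_free 6 V E"
  shows "\<exists>S. lp_transversal V E S \<and> card S \<le> Suc 3"
proof (rule small_transversal)
  fix S D w x d
  assume h: "S \<subseteq> V" "w \<in> V" "D \<inter> closed_nbhd E S = {}" "x \<in> D" "d \<in> D"
    "E x d" "E w x" "\<not> E w d" "w \<notin> D"
  have "False" if "\<sigma> \<in> S" "E w \<sigma>" "E \<sigma> y" "E y y'" "\<not> E \<sigma> y'"
    "y \<in> rest {w, x, d}" "y' \<in> rest {w, x, d}" for \<sigma> y y'
  proof -
    \<comment> \<open>\<open>d\<close> prolongs the path at its start. It misses \<open>w\<close> by
      the choice of the edge \<open>x d\<close>, and \<open>\<sigma>\<close> because it lies in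
      \<open>D\<close>; its membership in the new set keeps \<open>y\<close> and \<open>y'\<close>
      nonadjacent to it.\<close>
    have "\<not> E x \<sigma>" "\<not> E d \<sigma>" "\<not> E d w" "E d x"
      using h that E_sym unfolding closed_nbhd_def by blast+
    then have "has_induced_path 6 V E"
      using h that by (intro induced_path_6[of d x w \<sigma> y y']) (auto simp: E_commute closed_nbhd_def)
    then show False using assms by (simp add: P_free_def)
  qed
  moreover have "x \<in> V" "d \<in> V" "w \<noteq> d" "card {w, x, d} \<le> 3"
    using h E_V by (auto simp: card_insert_if)
  ultimately show "\<exists>S'. S' \<subseteq> V \<and> connected_graph S' E \<and> card S' \<le> 3 \<and> w \<in> S' \<and> x \<in> S' \<and>
      S' \<subseteq> insert w D \<and>
      (\<forall>\<sigma> y y'. \<sigma> \<in> S \<longrightarrow> E w \<sigma> \<longrightarrow> E \<sigma> y \<longrightarrow> E y y' \<longrightarrow> \<not> E \<sigma> y' \<longrightarrow>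
        y \<in> rest S' \<longrightarrow> y' \<in> rest S' \<longrightarrow> False)"
    using h connected_graph_path3[of w x d] by (intro exI[of _ "{w, x, d}"]) blast
qed simp

end

theorem theorem3p4:
  fixes V :: "'a set" and E :: "'a \<Rightarrow> 'a \<Rightarrow> bool" and t :: nat
  assumes "t \<in> {5, 6}"
    and "simple_graph V E"
    and "connected_graph V E"
    and "P_free t V E"
  shows "lpt V E \<le> t - 2"
proof -
  interpret conn_graph V E using assms by unfold_locales
  \<comment> \<open>The bounds \<open>Suc 2\<close> and \<open>Suc 3\<close> are the two values of
    \<open>t - 2\<close>.\<close>
  have "\<exists>S. lp_transversal V E S \<and> card S \<le> t - 2"
    using transversal_P5_free transversal_P6_free assms by auto
  then obtain S where "lp_transversal V E S" "card S \<le> t - 2" by blast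
  then show ?thesis
    unfolding lpt_def by (metis (mono_tags, lifting) Least_le order_trans)
qed

end
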